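(* Let $q>2$, $\beta>0$ and $0\le\rho\le(2q)^{-1.5}$. Let $\mathbf{Z}_1,\dots,\mathbf{Z}_n$ be independent real random variables with $\mathbb{E}[\mathbf{Z}_i]=0$, $\mathbb{E}[\mathbf{Z}_i^2]=1$, and let $\sigma_i>0$ satisfy $\mathbb{E}[|\mathbf{Z}_i|^q]=\sigma_i^{2-q}$. Suppose $f=\sum_{S\subseteq[n]}a_S\prod_{i\in S}\mathbf{Z}_i$ (real $a_S$) satisfies $\mathrm{I}_S[f]\le\beta\|f\|_2^2$ for all $S\subseteq[n]$. Then \[\|\mathrm{T}_\rho f\|_q\le\beta^{\frac{q-2}{2q}}\|f\|_2.\]
   Context: For $f=\sum_S a_S\prod_{i\in S}\mathbf{Z}_i$: $\mathrm{T}_\rho f=\sum_S\rho^{|S|}a_S\prod_{i\in S}\mathbf{Z}_i$, $\mathrm{D}_T[f]=\sum_{S\supseteq T}a_S\prod_{i\in S\setminus T}\mathbf{Z}_i$, $\sigma_S=\prod_{i\in S}\sigma_i$, and $\mathrm{I}_S[f]=\|\sigma_S^{-1}\mathrm{D}_S[f]\|_2^2$. Norms are $L^r$ norms of random variables. *)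

theory Defs
  imports "HOL-Probability.Probability"
begin

text \<open>
  The Bochner integral of a non-integrable function is \<open>0\<close>, so \<open>Lnorm M r X\<close> is the
  \<open>L\<^sup>r\<close> norm of \<open>X\<close> only if \<open>\<bar>X\<bar>\<^sup>r\<close> is integrable. Lemma \<open>multilinear_integrable_powr\<close>
  below shows that this is the case for all the random variables considered here.
\<close>

definition Lnorm :: "'a measure \<Rightarrow> real \<Rightarrow> ('a \<Rightarrow> real) \<Rightarrow> real" where
  "Lnorm M r X = (\<integral>\<omega>. \<bar>X \<omega>\<bar> powr r \<partial>M) powr (1 / r)"

text \<open>
  A multilinear polynomial in \<open>Z 1, \<dots>, Z n\<close> is given by its coefficient family \<open>a\<close>, of which
  only the values on subsets of \<open>{1..n}\<close> matter. For independent \<open>Z i\<close> of mean 0 and variance 1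
  the monomials are orthonormal, so the random variable determines these coefficients; the
  operators below therefore take the coefficients as argument.
\<close>

definition multilinear ::
  "nat \<Rightarrow> (nat \<Rightarrow> 'a \<Rightarrow> real) \<Rightarrow> (nat set \<Rightarrow> real) \<Rightarrow> 'a \<Rightarrow> real" where
  "multilinear n Z a = (\<lambda>\<omega>. \<Sum>S\<in>Pow {1..n}. a S * (\<Prod>i\<in>S. Z i \<omega>))"

definition noise_op ::
  "nat \<Rightarrow> (nat \<Rightarrow> 'a \<Rightarrow> real) \<Rightarrow> real \<Rightarrow> (nat set \<Rightarrow> real) \<Rightarrow> 'a \<Rightarrow> real" where
  "noise_op n Z \<rho> a = (\<lambda>\<omega>. \<Sum>S\<in>Pow {1..n}. \<rho> ^ card S * a S * (\<Prod>i\<in>S. Z i \<omega>))"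

definition deriv_op ::
  "nat \<Rightarrow> (nat \<Rightarrow> 'a \<Rightarrow> real) \<Rightarrow> nat set \<Rightarrow> (nat set \<Rightarrow> real) \<Rightarrow> 'a \<Rightarrow> real" where
  "deriv_op n Z T a = (\<lambda>\<omega>. \<Sum>S | T \<subseteq> S \<and> S \<subseteq> {1..n}. a S * (\<Prod>i\<in>S - T. Z i \<omega>))"

definition gen_influence ::
  "'a measure \<Rightarrow> nat \<Rightarrow> (nat \<Rightarrow> 'a \<Rightarrow> real) \<Rightarrow> (nat \<Rightarrow> real) \<Rightarrow> nat set \<Rightarrow>
    (nat set \<Rightarrow> real) \<Rightarrow> real" where
  "gen_influence M n Z \<sigma> S a =
     (Lnorm M 2 (\<lambda>\<omega>. inverse (\<Prod>i\<in>S. \<sigma> i) * deriv_op n Z S a \<omega>))\<^sup>2"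

lemma noise_op_multilinear: "noise_op n Z \<rho> a = multilinear n Z (\<lambda>S. \<rho> ^ card S * a S)"
  by (simp add: noise_op_def multilinear_def)

lemma deriv_op_multilinear:
  assumes "T \<subseteq> {1..n}"
  shows "deriv_op n Z T a = multilinear n Z (\<lambda>S. if S \<inter> T = {} then a (S \<union> T) else 0)"
proof
  fix \<omega>
  have "multilinear n Z (\<lambda>S. if S \<inter> T = {} then a (S \<union> T) else 0) \<omega> =
      (\<Sum>S | S \<subseteq> {1..n} \<and> S \<inter> T = {}. a (S \<union> T) * (\<Prod>i\<in>S. Z i \<omega>))"
    unfolding multilinear_def by (rule sum.mono_neutral_cong_right) auto
  also have "\<dots> = deriv_op n Z T a \<omega>"
    unfolding deriv_op_def
  proof (rule sum.reindex_bij_witness[where i = "\<lambda>S. S - T" and j = "\<lambda>S. S \<union> T"])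
    fix S assume S: "S \<in> {S. S \<subseteq> {1..n} \<and> S \<inter> T = {}}"
    then have "S \<union> T - T = S" by auto
    then show "a (S \<union> T) * (\<Prod>i\<in>S \<union> T - T. Z i \<omega>) = a (S \<union> T) * (\<Prod>i\<in>S. Z i \<omega>)" by simp
  qed (use assms in auto)
  finally show "deriv_op n Z T a \<omega> = multilinear n Z (\<lambda>S. if S \<inter> T = {} then a (S \<union> T) else 0) \<omega>"
    by simp
qed

lemma (in prob_space) integrable_sum_powr:
  fixes g :: "'b \<Rightarrow> 'a \<Rightarrow> real"
  assumes r: "0 < r" and "finite A"
    and "\<And>x. x \<in> A \<Longrightarrow> g x \<in> borel_measurable M"
    and "\<And>x. x \<in> A \<Longrightarrow> integrable M (\<lambda>\<omega>. \<bar>g x \<omega>\<bar> powr r)"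
  shows "integrable M (\<lambda>\<omega>. \<bar>\<Sum>x\<in>A. g x \<omega>\<bar> powr r)"
  using assms(2-)
proof (induction A rule: finite_induct)
  case empty
  then show ?case by simp
next
  case (insert x F)
  let ?s = "\<lambda>\<omega>. \<Sum>x\<in>F. g x \<omega>"
  have "integrable M (\<lambda>\<omega>. 2 powr r * (\<bar>g x \<omega>\<bar> powr r + \<bar>?s \<omega>\<bar> powr r))"
    using insert by auto
  moreover have "(\<lambda>\<omega>. \<bar>\<Sum>x\<in>insert x F. g x \<omega>\<bar> powr r) \<in> borel_measurable M"
  proof -
    have "(\<lambda>\<omega>. \<Sum>x\<in>insert x F. g x \<omega>) \<in> borel_measurable M"
      using insert.prems(1) by (rule borel_measurable_sum)
    then show ?thesis by measurable
  qed
  moreover have "\<bar>u + v\<bar> powr r \<le> 2 powr r * (\<bar>u\<bar> powr r + \<bar>v\<bar> powr r)" for u v :: real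
  proof -
    have "\<bar>u + v\<bar> powr r \<le> (2 * max \<bar>u\<bar> \<bar>v\<bar>) powr r"
      using r by (intro powr_mono2) auto
    also have "\<dots> = 2 powr r * max \<bar>u\<bar> \<bar>v\<bar> powr r"
      by (simp add: powr_mult)
    also have "\<dots> \<le> 2 powr r * (\<bar>u\<bar> powr r + \<bar>v\<bar> powr r)"
      by (intro mult_left_mono) (auto simp: max_def)
    finally show ?thesis .
  qed
  ultimately show ?case
    using insert.hyps by (elim Bochner_Integration.integrable_bound) auto
qed

lemma (in prob_space) multilinear_integrable_powr:
  assumes r: "0 < r"
    and indep: "indep_vars (\<lambda>_. borel) Z {1..n}"
    and int: "\<And>i. i \<in> {1..n} \<Longrightarrow> integrable M (\<lambda>\<omega>. \<bar>Z i \<omega>\<bar> powr r)"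
  shows "integrable M (\<lambda>\<omega>. \<bar>multilinear n Z a \<omega>\<bar> powr r)"
  unfolding multilinear_def
proof (rule integrable_sum_powr[OF r])
  fix S assume "S \<in> Pow {1..n}"
  then have S: "S \<subseteq> {1..n}" "finite S" by (auto intro: finite_subset)
  have Z: "Z i \<in> borel_measurable M" if "i \<in> {1..n}" for i
    using indep that unfolding indep_vars_def by auto
  show "(\<lambda>\<omega>. a S * (\<Prod>i\<in>S. Z i \<omega>)) \<in> borel_measurable M"
    using S Z by (intro borel_measurable_times borel_measurable_prod) auto
  have "indep_vars (\<lambda>_. borel) (\<lambda>i \<omega>. \<bar>Z i \<omega>\<bar> powr r) S"
    by (rule indep_vars_compose2[OF indep_vars_subset[OF indep S(1)]]) measurable
  then have "integrable M (\<lambda>\<omega>. \<Prod>i\<in>S. \<bar>Z i \<omega>\<bar> powr r)"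
    using S int by (intro indep_vars_integrable) auto
  then have "integrable M (\<lambda>\<omega>. \<bar>a S\<bar> powr r * (\<Prod>i\<in>S. \<bar>Z i \<omega>\<bar> powr r))"
    by simp
  then show "integrable M (\<lambda>\<omega>. \<bar>a S * (\<Prod>i\<in>S. Z i \<omega>)\<bar> powr r)"
    by (simp add: abs_mult abs_prod powr_mult prod_powr_distrib)
qed simp

end

theory Submission
  imports Defs
begin

text \<open>
  Let \<open>C = (2q+1)\<^sup>q\<close>. The claim follows from
  \<open>E \<bar>\<Sum>\<^sub>U b\<^sub>U Z\<^sup>U\<bar>\<^sup>q \<le> \<Sum>\<^sub>S C\<^bsup>|S|\<^esup> (\<Prod>\<^bsub>i\<in>S\<^esub> E \<bar>Z\<^sub>i\<bar>\<^sup>q) (\<Sum>\<^bsub>T \<inter> S = {}\<^esub> (4q)\<^bsup>|T|\<^esup> (b\<^bsub>S \<union> T\<^esub>)\<^sup>2)\<^bsup>q/2\<^esup>\<close>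
  with \<open>b\<^sub>U = \<rho>\<^bsup>|U|\<^esup> a\<^sub>U\<close>: the inner sum is at most the squared norm of the derivative along \<open>S\<close>, and
  the influence bound, applied to its power \<open>(q-2)/2\<close>, cancels the \<open>q\<close>-th moments. What remains is
  at most \<open>\<Sum>\<^sub>U (C \<rho>\<^sup>q + 4q \<rho>\<^sup>2)\<^bsup>|U|\<^esup> a\<^sub>U\<^sup>2\<close>, and \<open>C \<rho>\<^sup>q + 4q \<rho>\<^sup>2 \<le> 1\<close>.

  The inequality above is proved by removing one variable at a time. A single polynomial
  \<open>F = G + Z H\<close> then gives rise to the two polynomials \<open>G\<close> and \<open>H\<close>, so the induction is over sums of
  squares \<open>\<Sum>\<^sub>j F\<^sub>j\<^sup>2 = X + 2 Z d + Z\<^sup>2 Y\<close> with \<open>d\<^sup>2 \<le> X Y\<close>; a pointwise inequality bounds the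
  expectation over \<open>Z\<close> of the power \<open>q/2\<close> by \<open>(X + 4q Y)\<^bsup>q/2\<^esup> + C (E \<bar>Z\<bar>\<^sup>q) Y\<^bsup>q/2\<^esup>\<close>.
\<close>

subsection \<open>Pointwise inequalities\<close>

text \<open>For \<open>v = - t < 0\<close> the bound passes through \<open>1 / (1 + t)\<close>: the
  product \<open>(1 - t + t^2) * (1 + t) = 1 + t^3\<close> is at least 1, and \<open>exp t\<close>
  is at least \<open>1 + t\<close>.\<close>

lemma exp_le_quadratic:
  fixes v :: real
  assumes "\<bar>v\<bar> \<le> 1"
  shows "exp v \<le> 1 + v + v\<^sup>2"
proof (cases "v \<ge> 0")
  case True
  then show ?thesis using assms exp_bound by auto
next
  case False
  define t where "t = - v"
  have t: "t > 0" "t \<le> 1" using False assms by (auto simp: t_def)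
  have "(1 - t + t\<^sup>2) * (1 + t) = 1 + t ^ 3"
    by (simp add: power2_eq_square power3_eq_cube algebra_simps)
  also have "\<dots> \<ge> 1" using t by simp
  finally have "1 / (1 + t) \<le> 1 - t + t\<^sup>2"
    using t by (simp add: divide_le_eq)
  moreover have "exp (- t) \<le> 1 / (1 + t)"
    using t exp_ge_add_one_self[of t] by (simp add: exp_minus inverse_eq_divide frac_le)
  ultimately show ?thesis by (simp add: t_def)
qed

text \<open>Write the power as \<open>exp (p * ln (1 + u))\<close> and use
  \<open>ln (1 + u) \<le> u\<close>. The first-order term stays exact, which matters because it has
  to average to zero later.\<close>

lemma one_plus_powr_le_quadratic:
  fixes u p :: real
  assumes "u > -1" "p \<ge> 0" "\<bar>p * u\<bar> \<le> 1"
  shows "(1 + u) powr p \<le> 1 + p * u + (p * u)\<^sup>2"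
proof -
  have "(1 + u) powr p = exp (p * ln (1 + u))"
    using assms by (simp add: powr_def)
  also have "\<dots> \<le> exp (p * u)"
    using assms ln_add_one_self_le_self2[of u] by (simp add: mult_left_mono)
  also have "\<dots> \<le> 1 + p * u + (p * u)\<^sup>2"
    by (rule exp_le_quadratic[OF assms(3)])
  finally show ?thesis .
qed

text \<open>Convexity: the graph of the power lies above its tangent at \<open>x\<close>. The mean
  value theorem needs \<open>x > 0\<close>; at \<open>x = 0\<close> the left side vanishes. It
  serves to absorb the second-order term of the expansion into a larger base.\<close>

lemma powr_tangent_le:
  fixes x y p :: real
  assumes "p > 1" "x \<ge> 0" "y \<ge> 0"
  shows "x powr p + p * (x powr (p - 1) * y) \<le> (x + y) powr p"
proof (cases "x = 0")
  case True
  then show ?thesis using assms by simp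
next
  case False
  then have x: "x > 0" using assms by simp
  show ?thesis
  proof (cases "y = 0")
    case False
    then have y: "y > 0" using assms by simp
    have "\<exists>z>x. z < x + y \<and> (x + y) powr p - x powr p = (x + y - x) * (p * z powr (p - 1))"
      using x y by (intro MVT2) (auto intro!: derivative_eq_intros)
    then obtain z where z: "x < z" "(x + y) powr p - x powr p = y * (p * z powr (p - 1))"
      by auto
    have "x powr (p - 1) \<le> z powr (p - 1)"
      using x z assms by (intro powr_mono2) auto
    then have "y * (p * x powr (p - 1)) \<le> y * (p * z powr (p - 1))"
      using assms by (intro mult_left_mono) auto
    then show ?thesis using z(2) by (simp add: algebra_simps)
  qed simp
qed

text \<open>Two regimes. If \<open>x \<le> 2 * q * w\<close>, the last term alone dominates and the
  others add up to something nonnegative. Otherwise the perturbation is small relative to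
  \<open>x^2\<close> and a quadratic expansion applies. The term linear in \<open>d\<close> keeps
  its sign and its exact coefficient.\<close>

lemma powr_half_perturbation_le:
  fixes x w d q :: real
  assumes q: "q > 2" and x: "x \<ge> 0" and w: "w \<ge> 0" and d: "\<bar>d\<bar> \<le> x * w"
  shows "(x\<^sup>2 + 2 * d + w\<^sup>2) powr (q / 2) \<le> x powr q + q * (x powr (q - 2) * d)
    + 2 * q\<^sup>2 * (x powr (q - 2) * w\<^sup>2) + (2 * q + 1) powr q * w powr q"
proof (cases "x \<le> 2 * q * w")
  case True
  have "0 \<le> (x - w)\<^sup>2" by simp
  then have nn: "0 \<le> x\<^sup>2 + 2 * d + w\<^sup>2"
    using d by (simp add: power2_eq_square algebra_simps abs_le_iff)
  have "x\<^sup>2 + 2 * d + w\<^sup>2 \<le> (x + w)\<^sup>2"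
    using d by (simp add: power2_eq_square algebra_simps abs_le_iff)
  also have "\<dots> \<le> ((2 * q + 1) * w)\<^sup>2"
    using True x w by (intro power_mono) (auto simp: algebra_simps)
  finally have "(x\<^sup>2 + 2 * d + w\<^sup>2) powr (q / 2) \<le> (((2 * q + 1) * w)\<^sup>2) powr (q / 2)"
    using nn q by (intro powr_mono2) auto
  also have "\<dots> = ((2 * q + 1) * w) powr q"
    using q w by (simp flip: powr_numeral add: powr_powr)
  also have "\<dots> = (2 * q + 1) powr q * w powr q"
    using q w by (simp add: powr_mult)
  finally have 1: "(x\<^sup>2 + 2 * d + w\<^sup>2) powr (q / 2) \<le> (2 * q + 1) powr q * w powr q" .
  \<comment> \<open>Completing the square, with \<open>d \<ge> - (x * w)\<close>, shows that the
    three remaining terms have a nonnegative sum.\<close>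
  have "0 \<le> (x - q * w / 2)\<^sup>2 + 7 / 4 * (q * w)\<^sup>2" by simp
  also have "\<dots> = x\<^sup>2 - q * (x * w) + 2 * q\<^sup>2 * w\<^sup>2"
    by (simp add: power2_eq_square field_simps)
  also have "\<dots> \<le> x\<^sup>2 + q * d + 2 * q\<^sup>2 * w\<^sup>2"
    using mult_left_mono[of "- (x * w)" d q] d q by (simp add: abs_le_iff)
  finally have "0 \<le> x powr (q - 2) * (x\<^sup>2 + q * d + 2 * q\<^sup>2 * w\<^sup>2)" by simp
  moreover have "x powr (q - 2) * x\<^sup>2 = x powr q"
    using x by (simp flip: powr_numeral powr_add)
  ultimately show ?thesis using 1 by (simp add: algebra_simps)
next
  case False
  then have x0: "x > 0" using x w q by (smt (verit) mult_nonneg_nonneg)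
  \<comment> \<open>Scaling to \<open>x = 1\<close>: the case assumption becomes
    \<open>q * s < 1 / 2\<close>, and the hypothesis on \<open>d\<close> becomes
    \<open>\<bar>e\<bar> \<le> s\<close>.\<close>
  define s e where "s = w / x" and "e = d / x\<^sup>2"
  have w_eq: "w = s * x" and d_eq: "d = e * x\<^sup>2" using x0 by (auto simp: s_def e_def)
  have s0: "s \<ge> 0" using w x0 by (simp add: s_def)
  have qs: "q * s < 1 / 2" using False x0 by (simp add: s_def field_simps)
  have "2 * s \<le> q * s" using q s0 by (intro mult_right_mono) auto
  then have s4: "s \<le> 1 / 4" using qs by linarith
  have es: "\<bar>e\<bar> \<le> s"
    using d x0 by (simp add: e_def s_def abs_divide field_simps power2_eq_square)
  define u where "u = 2 * e + s\<^sup>2"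
  have ss: "s\<^sup>2 \<le> s / 4" using s4 s0 mult_right_mono[of s "1/4" s] by (simp add: power2_eq_square)
  \<comment> \<open>\<open>2 * s + s / 4 = 9 / 4 * s\<close>. Hence
    \<open>\<bar>u\<bar> \<le> 9 / 16\<close> and \<open>\<bar>q / 2 * u\<bar> < 9 / 16\<close>,
    within the range of the quadratic bound.\<close>
  have u: "\<bar>u\<bar> \<le> 9 / 4 * s" using es ss s0 zero_le_power2[of s] by (simp only: u_def abs_le_iff) linarith
  then have pu: "\<bar>q / 2 * u\<bar> \<le> 9 / 8 * (q * s)"
    using q mult_left_mono[of "\<bar>u\<bar>" "9 / 4 * s" "q / 2"] by (simp add: abs_mult)
  have "(1 + u) powr (q / 2) \<le> 1 + q / 2 * u + (q / 2 * u)\<^sup>2"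
    using q pu qs u s4 by (intro one_plus_powr_le_quadratic) auto
  also have "(q / 2 * u)\<^sup>2 \<le> (9 / 8 * (q * s))\<^sup>2"
    using pu by (metis power2_abs power_mono abs_ge_zero)
  also have "\<dots> = 81 / 64 * (q\<^sup>2 * s\<^sup>2)" by (simp add: power2_eq_square)
  \<comment> \<open>The part \<open>s^2\<close> of \<open>u\<close> contributes
    \<open>q / 2 * s^2\<close>, at most a quarter of \<open>q^2 * s^2\<close>, and
    \<open>1 / 4 + 81 / 64 < 2\<close>.\<close>
  also have "1 + q / 2 * u + 81 / 64 * (q\<^sup>2 * s\<^sup>2) \<le> 1 + q * e + 2 * q\<^sup>2 * s\<^sup>2"
  proof -
    have "2 * q \<le> q\<^sup>2" using q by (simp add: power2_eq_square)
    then have "2 * q * s\<^sup>2 \<le> q\<^sup>2 * s\<^sup>2" by (intro mult_right_mono) auto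
    moreover have "0 \<le> q\<^sup>2 * s\<^sup>2" by simp
    ultimately have "q / 2 * s\<^sup>2 + 81 / 64 * (q\<^sup>2 * s\<^sup>2) \<le> 2 * (q\<^sup>2 * s\<^sup>2)" by linarith
    then show ?thesis by (simp add: u_def distrib_left)
  qed
  finally have main: "(1 + u) powr (q / 2) \<le> 1 + q * e + 2 * q\<^sup>2 * s\<^sup>2" by simp
  have "x\<^sup>2 + 2 * d + w\<^sup>2 = x\<^sup>2 * (1 + u)"
    by (simp add: w_eq d_eq u_def power2_eq_square algebra_simps)
  then have "(x\<^sup>2 + 2 * d + w\<^sup>2) powr (q / 2) = (x\<^sup>2) powr (q / 2) * (1 + u) powr (q / 2)"
    by (simp add: powr_mult)
  also have "(x\<^sup>2) powr (q / 2) = x powr q"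
    using x0 by (simp flip: powr_numeral add: powr_powr)
  also have "x powr q * (1 + u) powr (q / 2) \<le> x powr q * (1 + q * e + 2 * q\<^sup>2 * s\<^sup>2)"
    using main by (intro mult_left_mono) auto
  also have "x powr q = x powr (q - 2) * x\<^sup>2"
    using x0 by (simp flip: powr_numeral powr_add)
  finally have "(x\<^sup>2 + 2 * d + w\<^sup>2) powr (q / 2)
      \<le> x powr (q - 2) * x\<^sup>2 + q * (x powr (q - 2) * d) + 2 * q\<^sup>2 * (x powr (q - 2) * w\<^sup>2)"
    by (simp add: w_eq d_eq power2_eq_square algebra_simps)
  moreover have "x powr (q - 2) * x\<^sup>2 = x powr q"
    using x0 by (simp flip: powr_numeral powr_add)
  moreover have "0 \<le> (2 * q + 1) powr q * w powr q" by simp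
  ultimately show ?thesis by linarith
qed

text \<open>The preceding inequality at \<open>x = sqrt X\<close>,
  \<open>w = \<bar>z\<bar> * sqrt Y\<close> and \<open>z * d\<close> for \<open>d\<close>; its
  hypothesis is the Cauchy-Schwarz condition on \<open>d\<close>.\<close>

lemma powr_quadratic_form_le:
  fixes q X Y d z :: real
  assumes q: "q > 2" and XY: "X \<ge> 0" "Y \<ge> 0" and d: "d\<^sup>2 \<le> X * Y"
  shows "(X + 2 * (z * d) + z\<^sup>2 * Y) powr (q / 2) \<le> X powr (q / 2) + q * (X powr (q / 2 - 1) * d * z)
    + 2 * q\<^sup>2 * (X powr (q / 2 - 1) * Y * z\<^sup>2) + (2 * q + 1) powr q * (Y powr (q / 2) * \<bar>z\<bar> powr q)"
proof -
  have sq: "sqrt t powr r = t powr (r / 2)" if "t \<ge> 0" for t r :: real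
    using that by (simp flip: powr_half_sqrt add: powr_powr)
  have "\<bar>d\<bar> \<le> sqrt X * sqrt Y"
    using d by (metis real_sqrt_abs real_sqrt_le_mono real_sqrt_mult)
  then have "\<bar>z * d\<bar> \<le> sqrt X * (\<bar>z\<bar> * sqrt Y)"
    using mult_left_mono[of "\<bar>d\<bar>" "sqrt X * sqrt Y" "\<bar>z\<bar>"] by (simp add: abs_mult algebra_simps)
  from powr_half_perturbation_le[OF q _ _ this] XY show ?thesis
    by (simp add: power_mult_distrib sq powr_mult diff_divide_distrib algebra_simps)
qed

text \<open>With \<open>k = 2 * q > 4\<close> and \<open>\<rho>^2 \<le> 1 / k^3\<close>, the two
  summands are at most \<open>25 / 64\<close> and \<open>1 / 8\<close>.\<close>

lemma noise_constant_le_one: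
  fixes q \<rho> :: real
  assumes q: "q > 2" and \<rho>: "0 \<le> \<rho>" "\<rho> \<le> (2 * q) powr (-1.5)"
  shows "(2 * q + 1) powr q * \<rho> powr q + 4 * q * \<rho>\<^sup>2 \<le> 1"
proof -
  define k where "k = 2 * q"
  have k: "k > 4" using q by (simp add: k_def)
  have "\<rho>\<^sup>2 \<le> (k powr (-1.5))\<^sup>2" using \<rho> by (intro power_mono) (auto simp: k_def)
  also have "\<dots> = k powr (-3)" using k by (simp flip: powr_numeral add: powr_powr)
  also have "\<dots> = 1 / k ^ 3" using k by (simp add: powr_minus_divide)
  finally have \<rho>2: "\<rho>\<^sup>2 \<le> 1 / k ^ 3" .
  have "2 * k * \<rho>\<^sup>2 \<le> 2 * k * (1 / k ^ 3)" using \<rho>2 k by (intro mult_left_mono) auto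
  also have "\<dots> = 2 / k\<^sup>2" using k by (simp add: power2_eq_square power3_eq_cube field_simps)
  also have "\<dots> \<le> 2 / 4\<^sup>2" using k by (intro divide_left_mono power_mono) auto
  finally have 1: "2 * k * \<rho>\<^sup>2 \<le> 1 / 8" by simp
  have "((k + 1) * \<rho>)\<^sup>2 \<le> (k + 1)\<^sup>2 * (1 / k ^ 3)"
    using mult_left_mono[OF \<rho>2, of "(k + 1)\<^sup>2"] by (simp add: power_mult_distrib)
  also have "\<dots> \<le> (5 / 4 * k)\<^sup>2 * (1 / k ^ 3)"
    using k by (intro mult_right_mono power_mono) auto
  also have "\<dots> = 25 / 16 / k" using k by (simp add: power2_eq_square power3_eq_cube field_simps)
  also have "\<dots> \<le> 25 / 16 / 4" using k by (intro divide_left_mono) auto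
  finally have 2: "((k + 1) * \<rho>)\<^sup>2 \<le> 25 / 64" by simp
  have "(k + 1) powr q * \<rho> powr q = ((k + 1) * \<rho>) powr q"
    using k \<rho> by (simp add: powr_mult)
  \<comment> \<open>The base is at most 1, so lowering the exponent from \<open>q\<close> to 2
    increases the power.\<close>
  also have "\<dots> \<le> ((k + 1) * \<rho>) powr 2"
  proof (rule powr_mono')
    show "(k + 1) * \<rho> \<le> 1" using 2 by (rule_tac power2_le_imp_le) auto
  qed (use q k \<rho> in auto)
  also have "\<dots> = ((k + 1) * \<rho>)\<^sup>2" using k \<rho> by (simp add: powr_numeral)
  finally show ?thesis using 1 2 by (simp add: k_def)
qed

subsection \<open>Sums over subsets and sums of squares\<close>

lemma sum_Pow_insert:
  assumes "finite A" "x \<notin> A"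
  shows "(\<Sum>S\<in>Pow (insert x A). f S) = (\<Sum>S\<in>Pow A. f S) + (\<Sum>S\<in>Pow A. f (insert x S))"
proof -
  have "inj_on (insert x) (Pow A)" using assms by (auto simp: inj_on_def)
  moreover have "Pow A \<inter> insert x ` Pow A = {}" using assms by auto
  ultimately show ?thesis
    using assms by (simp add: Pow_insert sum.union_disjoint sum.reindex)
qed

text \<open>Binomial theorem over sets: \<open>U\<close> arises from every splitting into disjoint
  \<open>S\<close> and \<open>T\<close>, and each element of \<open>U\<close> contributes \<alpha>
  or \<gamma>. In the induction the new element lies in \<open>S\<close>, in \<open>T\<close> or in
  neither.\<close>

lemma sum_Pow_disjoint_pairs:
  fixes g :: "'a set \<Rightarrow> 'b::comm_ring_1"
  assumes "finite A"
  shows "(\<Sum>S\<in>Pow A. \<alpha> ^ card S * (\<Sum>T\<in>Pow (A - S). \<gamma> ^ card T * g (S \<union> T)))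
    = (\<Sum>U\<in>Pow A. (\<alpha> + \<gamma>) ^ card U * g U)"
  using assms
proof (induction A arbitrary: g rule: finite_induct)
  case (insert x A)
  have fin: "finite S" "x \<notin> S" "finite (A - S)" if "S \<in> Pow A" for S
    using that insert.hyps by (auto intro: finite_subset)
  have "(\<Sum>T\<in>Pow (insert x A - S). \<gamma> ^ card T * g (S \<union> T))
      = (\<Sum>T\<in>Pow (A - S). \<gamma> ^ card T * g (S \<union> T))
        + \<gamma> * (\<Sum>T\<in>Pow (A - S). \<gamma> ^ card T * g (insert x (S \<union> T)))" if S: "S \<in> Pow A" for S
  proof -
    have "insert x A - S = insert x (A - S)" using fin[OF S] by auto
    moreover have "finite T" "x \<notin> T" if "T \<in> Pow (A - S)" for T
      using that insert.hyps by (auto intro: finite_subset)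
    ultimately show ?thesis
      using fin[OF S] insert.hyps
      by (simp add: sum_Pow_insert sum_distrib_left mult.assoc)
  qed
  moreover have "(\<Sum>T\<in>Pow (insert x A - insert x S). \<gamma> ^ card T * g (insert x S \<union> T))
      = (\<Sum>T\<in>Pow (A - S). \<gamma> ^ card T * g (insert x (S \<union> T)))" for S
  proof -
    have "insert x A - insert x S = A - S" using insert.hyps by auto
    then show ?thesis by simp
  qed
  \<comment> \<open>Placing \<open>x\<close> in \<open>S\<close> or in \<open>T\<close> leads to the
    same inner sum, so the two contributions merge with factor
    \<open>\<alpha> + \<gamma>\<close>.\<close>
  ultimately have "\<alpha> ^ card S * (\<Sum>T\<in>Pow (insert x A - S). \<gamma> ^ card T * g (S \<union> T))
      + \<alpha> ^ card (insert x S) * (\<Sum>T\<in>Pow (insert x A - insert x S). \<gamma> ^ card T * g (insert x S \<union> T))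
    = \<alpha> ^ card S * (\<Sum>T\<in>Pow (A - S). \<gamma> ^ card T * g (S \<union> T))
      + (\<alpha> + \<gamma>) * (\<alpha> ^ card S * (\<Sum>T\<in>Pow (A - S). \<gamma> ^ card T * g (insert x (S \<union> T))))"
    if "S \<in> Pow A" for S
    using fin[OF that] that by (simp add: algebra_simps)
  then have "(\<Sum>S\<in>Pow (insert x A). \<alpha> ^ card S * (\<Sum>T\<in>Pow (insert x A - S). \<gamma> ^ card T * g (S \<union> T)))
    = (\<Sum>S\<in>Pow A. \<alpha> ^ card S * (\<Sum>T\<in>Pow (A - S). \<gamma> ^ card T * g (S \<union> T)))
      + (\<alpha> + \<gamma>) * (\<Sum>S\<in>Pow A. \<alpha> ^ card S * (\<Sum>T\<in>Pow (A - S). \<gamma> ^ card T * g (insert x (S \<union> T))))"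
    unfolding sum_Pow_insert[OF insert.hyps] sum_distrib_left[of "\<alpha> + \<gamma>"] sum.distrib[symmetric]
    by (rule sum.cong[OF refl])
  also have "\<dots> = (\<Sum>U\<in>Pow A. (\<alpha> + \<gamma>) ^ card U * g U)
      + (\<alpha> + \<gamma>) * (\<Sum>U\<in>Pow A. (\<alpha> + \<gamma>) ^ card U * g (insert x U))"
    unfolding insert.IH insert.IH[of "\<lambda>U. g (insert x U)"] ..
  also have "\<dots> = (\<Sum>U\<in>Pow (insert x A). (\<alpha> + \<gamma>) ^ card U * g U)"
    unfolding sum_Pow_insert[OF insert.hyps] sum_distrib_left
    using fin by (intro arg_cong2[where f = "(+)"] sum.cong refl) (simp add: mult.assoc)
  finally show ?case .
qed simp

section \<open>Sums of squares of polynomials and the splitting off of the last variable\<close>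

lemma sum_list_Cauchy_Schwarz:
  fixes f g :: "'b \<Rightarrow> real"
  shows "(\<Sum>b\<leftarrow>L. f b * g b)\<^sup>2 \<le> (\<Sum>b\<leftarrow>L. (f b)\<^sup>2) * (\<Sum>b\<leftarrow>L. (g b)\<^sup>2)"
  using Cauchy_Schwarz_ineq_sum[of "\<lambda>i. f (L ! i)" "\<lambda>i. g (L ! i)" "{0..<length L}"]
  by (simp add: sum.list_conv_set_nth)

lemma abs_powr_eq_power2_powr: "\<bar>x\<bar> powr r = (x\<^sup>2) powr (r / 2)" for x r :: real
  using powr_powr[of "\<bar>x\<bar>" 2 "r / 2"] by simp

text \<open>The coefficients of \<open>H\<close> in \<open>F = G + Z (Suc n) * H\<close>. The part
  \<open>G\<close> keeps the family \<open>b\<close> itself, because \<open>multilinear n\<close>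
  reads only subsets of \<open>{1..n}\<close>.\<close>

definition shift_coeff :: "nat \<Rightarrow> (nat set \<Rightarrow> real) \<Rightarrow> nat set \<Rightarrow> real" where
  "shift_coeff n b = (\<lambda>S. b (insert (Suc n) S))"

text \<open>The squared Euclidean length of a vector of polynomials. With a list, replacing each
  family by two is a concatenation, and repeated families count separately.\<close>

definition square_sum ::
  "nat \<Rightarrow> (nat \<Rightarrow> 'a \<Rightarrow> real) \<Rightarrow> (nat set \<Rightarrow> real) list \<Rightarrow> 'a \<Rightarrow> real" where
  "square_sum n Z L \<omega> = (\<Sum>b\<leftarrow>L. (multilinear n Z b \<omega>)\<^sup>2)"

lemma atLeastAtMost_1_Suc: "{1..Suc n} = insert (Suc n) {1..n}"
  by auto

lemma sum_Pow_Suc: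
  "(\<Sum>S\<in>Pow {1..Suc n}. f S) = (\<Sum>S\<in>Pow {1..n}. f S) + (\<Sum>S\<in>Pow {1..n}. f (insert (Suc n) S))"
  unfolding atLeastAtMost_1_Suc by (rule sum_Pow_insert) auto

lemma multilinear_Suc:
  "multilinear (Suc n) Z b \<omega> = multilinear n Z b \<omega> + Z (Suc n) \<omega> * multilinear n Z (shift_coeff n b) \<omega>"
proof -
  have "(\<Sum>S\<in>Pow {1..n}. b (insert (Suc n) S) * (\<Prod>i\<in>insert (Suc n) S. Z i \<omega>)) =
      (\<Sum>S\<in>Pow {1..n}. Z (Suc n) \<omega> * (b (insert (Suc n) S) * (\<Prod>i\<in>S. Z i \<omega>)))"
  proof (rule sum.cong)
    fix S assume "S \<in> Pow {1..n}"
    then have "finite S" "Suc n \<notin> S" by (auto intro: finite_subset)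
    then show "b (insert (Suc n) S) * (\<Prod>i\<in>insert (Suc n) S. Z i \<omega>) =
        Z (Suc n) \<omega> * (b (insert (Suc n) S) * (\<Prod>i\<in>S. Z i \<omega>))" by simp
  qed simp
  then show ?thesis
    unfolding multilinear_def shift_coeff_def sum_Pow_Suc sum_distrib_left by simp
qed

lemma multilinear_scale: "multilinear n Z (\<lambda>S. c * b S) \<omega> = c * multilinear n Z b \<omega>"
  by (simp add: multilinear_def sum_distrib_left mult.assoc)

text \<open>Taking coordinate projections as variables turns the polynomial into a function of the
  tuple of the first \<open>n\<close> variables, the form in which independence from the next
  variable can be applied.\<close>

lemma multilinear_restrict:
  "multilinear n (\<lambda>i x. x i) b (\<lambda>i\<in>{1..n}. Z i \<omega>) = multilinear n Z b \<omega>"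
  unfolding multilinear_def
  by (intro sum.cong refl arg_cong2[where f = "(*)"] prod.cong) auto

lemma borel_measurable_multilinear:
  assumes "\<And>i. i \<in> {1..n} \<Longrightarrow> Z i \<in> borel_measurable N"
  shows "multilinear n Z b \<in> borel_measurable N"
  unfolding multilinear_def using assms
  by (intro borel_measurable_sum borel_measurable_times borel_measurable_prod) auto

lemma borel_measurable_sum_list [measurable (raw)]:
  fixes f :: "'c \<Rightarrow> 'a \<Rightarrow> real"
  assumes "\<And>b. f b \<in> borel_measurable N"
  shows "(\<lambda>\<omega>. \<Sum>b\<leftarrow>L. f b \<omega>) \<in> borel_measurable N"
  using assms by (induction L) auto

lemma square_sum_nonneg: "square_sum n Z L \<omega> \<ge> 0"
  by (auto simp: square_sum_def intro!: sum_list_nonneg)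

lemma square_sum_append: "square_sum n Z (L @ L') \<omega> = square_sum n Z L \<omega> + square_sum n Z L' \<omega>"
  by (simp add: square_sum_def)

lemma square_sum_scale:
  "square_sum n Z (map (\<lambda>b S. c * h b S) L) \<omega> = c\<^sup>2 * square_sum n Z (map h L) \<omega>"
  by (simp add: square_sum_def o_def multilinear_scale power_mult_distrib sum_list_const_mult)

lemma square_sum_restrict:
  "square_sum n (\<lambda>i x. x i) L (\<lambda>i\<in>{1..n}. Z i \<omega>) = square_sum n Z L \<omega>"
  unfolding square_sum_def multilinear_restrict ..

lemma borel_measurable_square_sum:
  assumes "\<And>i. i \<in> {1..n} \<Longrightarrow> Z i \<in> borel_measurable N"
  shows "square_sum n Z L \<in> borel_measurable N"
  unfolding square_sum_def using borel_measurable_multilinear[OF assms] by measurable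

lemma square_sum_Suc:
  "square_sum (Suc n) Z L \<omega> = square_sum n Z L \<omega>
    + 2 * (Z (Suc n) \<omega> * (\<Sum>b\<leftarrow>L. multilinear n Z b \<omega> * multilinear n Z (shift_coeff n b) \<omega>))
    + (Z (Suc n) \<omega>)\<^sup>2 * square_sum n Z (map (shift_coeff n) L) \<omega>"
  unfolding square_sum_def
  by (induction L) (auto simp: multilinear_Suc power2_eq_square algebra_simps)

subsection \<open>Moments\<close>

context prob_space
begin

lemma integrable_square_sum_powr:
  assumes q: "q > 0"
    and indep: "indep_vars (\<lambda>_. borel) Z {1..n}"
    and int: "\<And>i. i \<in> {1..n} \<Longrightarrow> integrable M (\<lambda>\<omega>. \<bar>Z i \<omega>\<bar> powr q)"
  shows "integrable M (\<lambda>\<omega>. square_sum n Z L \<omega> powr (q / 2))"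
proof -
  have Z: "Z i \<in> borel_measurable M" if "i \<in> {1..n}" for i
    using indep that unfolding indep_vars_def by auto
  have "integrable M (\<lambda>\<omega>. \<bar>\<Sum>k\<in>{0..<length L}. (multilinear n Z (L ! k) \<omega>)\<^sup>2\<bar> powr (q / 2))"
  proof (rule integrable_sum_powr)
    fix k
    have "\<bar>(multilinear n Z (L ! k) \<omega>)\<^sup>2\<bar> powr (q / 2) = \<bar>multilinear n Z (L ! k) \<omega>\<bar> powr q" for \<omega>
      by (simp add: abs_powr_eq_power2_powr)
    then show "integrable M (\<lambda>\<omega>. \<bar>(multilinear n Z (L ! k) \<omega>)\<^sup>2\<bar> powr (q / 2))"
      using multilinear_integrable_powr[OF q indep int] by simp
    show "(\<lambda>\<omega>. (multilinear n Z (L ! k) \<omega>)\<^sup>2) \<in> borel_measurable M"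
      using borel_measurable_multilinear[OF Z] by measurable
  qed (use q in auto)
  also have "(\<lambda>\<omega>. \<bar>\<Sum>k\<in>{0..<length L}. (multilinear n Z (L ! k) \<omega>)\<^sup>2\<bar> powr (q / 2))
      = (\<lambda>\<omega>. square_sum n Z L \<omega> powr (q / 2))"
    using square_sum_nonneg[of n Z L] by (simp add: square_sum_def sum.list_conv_set_nth)
  finally show ?thesis .
qed

text \<open>Restrictions to the disjoint index blocks \<open>{1..n}\<close> and
  \<open>{Suc n}\<close> are independent, and measurable functions preserve this.\<close>

lemma indep_var_prefix_last:
  assumes indep: "indep_vars (\<lambda>_. borel) Z {1..Suc n}"
    and h: "h \<in> borel_measurable (PiM {1..n} (\<lambda>_. borel))"
    and g: "g \<in> borel_measurable borel"
  shows "indep_var borel (\<lambda>\<omega>. h (\<lambda>i\<in>{1..n}. Z i \<omega>)) borel (\<lambda>\<omega>. g (Z (Suc n) \<omega>))"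
proof -
  have "indep_var borel (h \<circ> (\<lambda>\<omega>. \<lambda>i\<in>{1..n}. Z i \<omega>))
      borel ((\<lambda>x. g (x (Suc n))) \<circ> (\<lambda>\<omega>. \<lambda>i\<in>{Suc n}. Z i \<omega>))"
    using g by (intro indep_var_compose[OF indep_var_restrict[OF indep]] h) auto
  then show ?thesis by (simp add: o_def)
qed

text \<open>\<open>h\<close> lives on the product space and carries the measurability;
  \<open>H\<close> is the same quantity as a random variable on \<open>M\<close>, so that results
  are stated in the form in which they are used.\<close>

lemma prefix_times_last:
  fixes h :: "(nat \<Rightarrow> real) \<Rightarrow> real" and g :: "real \<Rightarrow> real"
  assumes indep: "indep_vars (\<lambda>_. borel) Z {1..Suc n}"
    and h: "h \<in> borel_measurable (PiM {1..n} (\<lambda>_. borel))"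
    and g: "g \<in> borel_measurable borel"
    and H: "\<And>\<omega>. h (\<lambda>i\<in>{1..n}. Z i \<omega>) = H \<omega>"
    and int: "integrable M H" "integrable M (\<lambda>\<omega>. g (Z (Suc n) \<omega>))"
  shows integrable_prefix_times_last: "integrable M (\<lambda>\<omega>. H \<omega> * g (Z (Suc n) \<omega>))"
    and expectation_prefix_times_last:
      "expectation (\<lambda>\<omega>. H \<omega> * g (Z (Suc n) \<omega>)) = expectation H * expectation (\<lambda>\<omega>. g (Z (Suc n) \<omega>))"
proof -
  have "indep_var borel H borel (\<lambda>\<omega>. g (Z (Suc n) \<omega>))"
    using indep_var_prefix_last[OF indep h g] by (simp only: H eta_contract_eq)
  from indep_var_integrable[OF this int] indep_var_lebesgue_integral[OF this int]
  show "integrable M (\<lambda>\<omega>. H \<omega> * g (Z (Suc n) \<omega>))"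
    "expectation (\<lambda>\<omega>. H \<omega> * g (Z (Suc n) \<omega>)) = expectation H * expectation (\<lambda>\<omega>. g (Z (Suc n) \<omega>))"
    by auto
qed

text \<open>Parseval's identity for the orthonormal monomials. In the square of
  \<open>G + Z (Suc n) * H\<close> the cross term has mean zero, and the factor
  \<open>(Z (Suc n))^2\<close> has mean one.\<close>

lemma expectation_multilinear_square:
  assumes "indep_vars (\<lambda>_. borel) Z {1..n}"
    and "\<And>i. i \<in> {1..n} \<Longrightarrow> integrable M (Z i) \<and> expectation (Z i) = 0"
    and "\<And>i. i \<in> {1..n} \<Longrightarrow>
      integrable M (\<lambda>\<omega>. (Z i \<omega>)\<^sup>2) \<and> expectation (\<lambda>\<omega>. (Z i \<omega>)\<^sup>2) = 1"
  shows "integrable M (\<lambda>\<omega>. (multilinear n Z b \<omega>)\<^sup>2) \<and>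
    expectation (\<lambda>\<omega>. (multilinear n Z b \<omega>)\<^sup>2) = (\<Sum>S\<in>Pow {1..n}. (b S)\<^sup>2)"
  using assms
proof (induction n arbitrary: b)
  case 0
  then show ?case by (simp add: multilinear_def prob_space)
next
  case (Suc n)
  have indep: "indep_vars (\<lambda>_. borel) Z {1..n}"
    using Suc.prems(1) by (rule indep_vars_subset) auto
  note IH = Suc.IH[OF indep Suc.prems(2,3)]
  have Z: "Z i \<in> borel_measurable M" if "i \<in> {1..Suc n}" for i
    using Suc.prems(1) that unfolding indep_vars_def by auto
  define G where "G = multilinear n Z b"
  define H where "H = multilinear n Z (shift_coeff n b)"
  define pr where "pr = (\<lambda>i (x :: nat \<Rightarrow> real). x i)"
  have pr: "multilinear n pr b (\<lambda>i\<in>{1..n}. Z i \<omega>) = multilinear n Z b \<omega>" for b \<omega>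
    unfolding pr_def by (rule multilinear_restrict)
  have prm[measurable]: "multilinear n pr b \<in> borel_measurable (PiM {1..n} (\<lambda>_. borel))" for b
    by (rule borel_measurable_multilinear) (auto simp: pr_def)
  have [measurable]: "G \<in> borel_measurable M" "H \<in> borel_measurable M"
    unfolding G_def H_def using Z by (auto intro!: borel_measurable_multilinear)
  have G2: "integrable M (\<lambda>\<omega>. (G \<omega>)\<^sup>2)"
    and EG: "expectation (\<lambda>\<omega>. (G \<omega>)\<^sup>2) = (\<Sum>S\<in>Pow {1..n}. (b S)\<^sup>2)"
    using IH[of b] by (auto simp: G_def)
  have H2: "integrable M (\<lambda>\<omega>. (H \<omega>)\<^sup>2)"
    and EH: "expectation (\<lambda>\<omega>. (H \<omega>)\<^sup>2) = (\<Sum>S\<in>Pow {1..n}. (b (insert (Suc n) S))\<^sup>2)"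
    using IH[of "shift_coeff n b"] by (auto simp: H_def shift_coeff_def)
  have GH: "integrable M (\<lambda>\<omega>. G \<omega> * H \<omega>)"
  proof (rule Bochner_Integration.integrable_bound)
    show "integrable M (\<lambda>\<omega>. (G \<omega>)\<^sup>2 + (H \<omega>)\<^sup>2)" using G2 H2 by simp
    have "\<bar>u * v\<bar> \<le> u\<^sup>2 + v\<^sup>2" for u v :: real
      using sum_squares_bound[of "\<bar>u\<bar>" "\<bar>v\<bar>"] mult_nonneg_nonneg[of "\<bar>u\<bar>" "\<bar>v\<bar>"]
      unfolding abs_mult power2_abs by linarith
    then show "AE \<omega> in M. norm (G \<omega> * H \<omega>) \<le> norm ((G \<omega>)\<^sup>2 + (H \<omega>)\<^sup>2)" by simp
  qed measurable
  have h: "(\<lambda>x. multilinear n pr b x * multilinear n pr (shift_coeff n b) x) \<in> borel_measurable (PiM {1..n} (\<lambda>_. borel))"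
    "(\<lambda>x. (multilinear n pr (shift_coeff n b) x)\<^sup>2) \<in> borel_measurable (PiM {1..n} (\<lambda>_. borel))"
    by measurable
  have g: "(\<lambda>z. z) \<in> borel_measurable (borel :: real measure)"
    "(\<lambda>z. z\<^sup>2) \<in> borel_measurable (borel :: real measure)"
    by measurable
  have Zn: "integrable M (Z (Suc n))" "expectation (Z (Suc n)) = 0"
    "integrable M (\<lambda>\<omega>. (Z (Suc n) \<omega>)\<^sup>2)" "expectation (\<lambda>\<omega>. (Z (Suc n) \<omega>)\<^sup>2) = 1"
    using Suc.prems(2,3)[of "Suc n"] by auto
  \<comment> \<open>Rewriting with \<open>pr\<close> makes the premise that identifies
    \<open>h\<close> with \<open>H\<close> an instance of reflexivity.\<close>
  note 1 = prefix_times_last[OF Suc.prems(1) h(1) g(1) _ GH[unfolded G_def H_def] Zn(1),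
      unfolded pr, OF refl, folded G_def H_def]
  note 2 = prefix_times_last[OF Suc.prems(1) h(2) g(2) _ H2[unfolded H_def] Zn(3),
      unfolded pr, OF refl, folded H_def]
  have eq: "(multilinear (Suc n) Z b \<omega>)\<^sup>2
      = (G \<omega>)\<^sup>2 + 2 * (G \<omega> * H \<omega> * Z (Suc n) \<omega>) + (H \<omega>)\<^sup>2 * (Z (Suc n) \<omega>)\<^sup>2" for \<omega>
    by (simp add: multilinear_Suc G_def H_def power2_eq_square algebra_simps)
  show ?case
    unfolding eq sum_Pow_Suc
    using G2 1 2 EG EH Zn by simp
qed

text \<open>Integrate \<open>powr_quadratic_form_le\<close> at \<open>z = Z (Suc n)\<close>. By
  independence the linear term vanishes and the quadratic one loses its factor \<open>z^2\<close>.
  The tangent inequality then absorbs it into the power of \<open>X + 4 * q * Y\<close>, which is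
  the sum of squares of the extended list.\<close>

lemma expectation_square_sum_Suc_le:
  assumes q: "q > 2"
    and indep: "indep_vars (\<lambda>_. borel) Z {1..Suc n}"
    and Z1: "integrable M (Z (Suc n))" "expectation (Z (Suc n)) = 0"
    and Z2: "integrable M (\<lambda>\<omega>. (Z (Suc n) \<omega>)\<^sup>2)" "expectation (\<lambda>\<omega>. (Z (Suc n) \<omega>)\<^sup>2) = 1"
    and Zq: "\<And>i. i \<in> {1..Suc n} \<Longrightarrow> integrable M (\<lambda>\<omega>. \<bar>Z i \<omega>\<bar> powr q)"
  shows "expectation (\<lambda>\<omega>. square_sum (Suc n) Z L \<omega> powr (q / 2))
    \<le> expectation (\<lambda>\<omega>. square_sum n Z (L @ map (\<lambda>b S. sqrt (4 * q) * shift_coeff n b S) L) \<omega> powr (q / 2))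
      + (2 * q + 1) powr q * expectation (\<lambda>\<omega>. \<bar>Z (Suc n) \<omega>\<bar> powr q)
        * expectation (\<lambda>\<omega>. square_sum n Z (map (shift_coeff n) L) \<omega> powr (q / 2))"
proof -
  have indep': "indep_vars (\<lambda>_. borel) Z {1..n}"
    using indep by (rule indep_vars_subset) auto
  have Z: "Z i \<in> borel_measurable M" if "i \<in> {1..Suc n}" for i
    using indep that unfolding indep_vars_def by auto
  have int: "integrable M (\<lambda>\<omega>. square_sum n Z L \<omega> powr (q / 2))" for L
    using integrable_square_sum_powr[OF _ indep' Zq] q by simp
  let ?c = "(2 * q + 1) powr q"
  let ?sL = "map (shift_coeff n) L"
  let ?p = "q / 2 - 1"
  define X where "X = square_sum n Z L"
  define Y where "Y = square_sum n Z ?sL"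
  define d where "d = (\<lambda>\<omega>. \<Sum>b\<leftarrow>L. multilinear n Z b \<omega> * multilinear n Z (shift_coeff n b) \<omega>)"
  define pr where "pr = (\<lambda>i (x :: nat \<Rightarrow> real). x i)"
  define d' where "d' = (\<lambda>x. \<Sum>b\<leftarrow>L. multilinear n pr b x * multilinear n pr (shift_coeff n b) x)"
  have prX: "square_sum n pr L (\<lambda>i\<in>{1..n}. Z i \<omega>) = X \<omega>"
    and prY: "square_sum n pr ?sL (\<lambda>i\<in>{1..n}. Z i \<omega>) = Y \<omega>"
    and prd: "d' (\<lambda>i\<in>{1..n}. Z i \<omega>) = d \<omega>" for \<omega>
    unfolding pr_def X_def Y_def d_def d'_def square_sum_restrict multilinear_restrict by auto
  have [measurable]: "multilinear n pr b \<in> borel_measurable (PiM {1..n} (\<lambda>_. borel))"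
    "square_sum n pr L' \<in> borel_measurable (PiM {1..n} (\<lambda>_. borel))" for b L'
    by (auto intro!: borel_measurable_multilinear borel_measurable_square_sum simp: pr_def)
  have [measurable]: "d' \<in> borel_measurable (PiM {1..n} (\<lambda>_. borel))"
    unfolding d'_def by measurable
  have [measurable]: "multilinear n Z b \<in> borel_measurable M" for b
    using Z by (auto intro!: borel_measurable_multilinear)
  have [measurable]: "X \<in> borel_measurable M" "Y \<in> borel_measurable M"
    unfolding X_def Y_def using Z by (auto intro!: borel_measurable_square_sum)
  have [measurable]: "d \<in> borel_measurable M"
    unfolding d_def by measurable
  have nn: "X \<omega> \<ge> 0" "Y \<omega> \<ge> 0" for \<omega>
    by (simp_all add: X_def Y_def square_sum_nonneg)
  have CS: "(d \<omega>)\<^sup>2 \<le> X \<omega> * Y \<omega>" for \<omega>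
    using sum_list_Cauchy_Schwarz[of "\<lambda>b. multilinear n Z b \<omega>" "\<lambda>b. multilinear n Z (shift_coeff n b) \<omega>" L]
    by (simp add: d_def X_def Y_def square_sum_def o_def)
  have intX: "integrable M (\<lambda>\<omega>. X \<omega> powr (q / 2))"
    and intY: "integrable M (\<lambda>\<omega>. Y \<omega> powr (q / 2))"
    unfolding X_def Y_def by (rule int)+
  have intXY: "integrable M (\<lambda>\<omega>. (X \<omega> + Y \<omega>) powr (q / 2))"
    using int[of "L @ ?sL"] by (simp add: X_def Y_def square_sum_append)
  \<comment> \<open>Integrability of the mixed terms follows by domination, with \<open>t\<close>
    equal to \<open>\<bar>d \<omega>\<bar>\<close> or \<open>Y \<omega>\<close>;
    \<open>X + Y\<close> is again a sum of squares.\<close>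
  have bnd: "X \<omega> powr ?p * t \<le> (X \<omega> + Y \<omega>) powr (q / 2)" if "0 \<le> t" "t \<le> X \<omega> + Y \<omega>" for t \<omega>
  proof -
    have "X \<omega> powr ?p * t \<le> (X \<omega> + Y \<omega>) powr ?p * (X \<omega> + Y \<omega>)"
      using that nn[of \<omega>] q by (intro mult_mono powr_mono2) auto
    also have "\<dots> = (X \<omega> + Y \<omega>) powr (q / 2)"
      using powr_mult_base[of "X \<omega> + Y \<omega>" ?p] nn[of \<omega>] by (simp add: mult.commute)
    finally show ?thesis .
  qed
  have d_le: "\<bar>d \<omega>\<bar> \<le> X \<omega> + Y \<omega>" for \<omega>
  proof -
    have "(d \<omega>)\<^sup>2 \<le> (X \<omega> + Y \<omega>)\<^sup>2"
      using CS[of \<omega>] mult_nonneg_nonneg[OF nn[of \<omega>]] zero_le_power2[of "X \<omega>"] zero_le_power2[of "Y \<omega>"]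
      unfolding power2_sum mult.assoc by linarith
    then show ?thesis using nn[of \<omega>] by (metis abs_le_square_iff abs_of_nonneg add_nonneg_nonneg)
  qed
  have intd: "integrable M (\<lambda>\<omega>. X \<omega> powr ?p * d \<omega>)"
    by (rule Bochner_Integration.integrable_bound[OF intXY])
       (auto simp: abs_mult intro!: bnd d_le)
  have intXpY: "integrable M (\<lambda>\<omega>. X \<omega> powr ?p * Y \<omega>)"
    by (rule Bochner_Integration.integrable_bound[OF intXY])
       (auto simp: abs_mult nn intro!: bnd)
  have m1: "(\<lambda>x. square_sum n pr L x powr ?p * d' x) \<in> borel_measurable (PiM {1..n} (\<lambda>_. borel))"
    by measurable
  have m2: "(\<lambda>x. square_sum n pr L x powr ?p * square_sum n pr ?sL x) \<in> borel_measurable (PiM {1..n} (\<lambda>_. borel))"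
    by measurable
  have m3: "(\<lambda>x. square_sum n pr ?sL x powr (q / 2)) \<in> borel_measurable (PiM {1..n} (\<lambda>_. borel))"
    by measurable
  have g: "(\<lambda>z. z) \<in> borel_measurable (borel :: real measure)"
    "(\<lambda>z. z\<^sup>2) \<in> borel_measurable (borel :: real measure)"
    "(\<lambda>z. \<bar>z\<bar> powr q) \<in> borel_measurable (borel :: real measure)"
    by measurable
  have Zn: "integrable M (\<lambda>\<omega>. \<bar>Z (Suc n) \<omega>\<bar> powr q)" by (rule Zq) simp
  note e1 = prefix_times_last[OF indep m1 g(1) _ intd Z1(1), unfolded prX prd Z1(2) mult_zero_right, OF refl]
  note e2 = prefix_times_last[OF indep m2 g(2) _ intXpY Z2(1), unfolded prX prY Z2(2) mult_1_right, OF refl]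
  note e3 = prefix_times_last[OF indep m3 g(3) _ intY Zn, unfolded prY, OF refl]
  \<comment> \<open>This is the origin of \<open>4 * q\<close>: the tangent slope
    \<open>q / 2\<close> times it must equal the coefficient \<open>2 * q^2\<close>.\<close>
  have tangent: "q / 2 * (X \<omega> powr ?p * (4 * q * Y \<omega>)) = 2 * q\<^sup>2 * (X \<omega> powr ?p * Y \<omega>)" for \<omega>
    by (simp add: power2_eq_square)
  have "expectation (\<lambda>\<omega>. square_sum (Suc n) Z L \<omega> powr (q / 2))
      \<le> expectation (\<lambda>\<omega>. X \<omega> powr (q / 2) + q * (X \<omega> powr ?p * d \<omega> * Z (Suc n) \<omega>)
        + 2 * q\<^sup>2 * (X \<omega> powr ?p * Y \<omega> * (Z (Suc n) \<omega>)\<^sup>2)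
        + ?c * (Y \<omega> powr (q / 2) * \<bar>Z (Suc n) \<omega>\<bar> powr q))"
  proof (rule integral_mono)
    show "integrable M (\<lambda>\<omega>. square_sum (Suc n) Z L \<omega> powr (q / 2))"
      using integrable_square_sum_powr[OF _ indep Zq] q by simp
    show "square_sum (Suc n) Z L \<omega> powr (q / 2) \<le> X \<omega> powr (q / 2)
        + q * (X \<omega> powr ?p * d \<omega> * Z (Suc n) \<omega>)
        + 2 * q\<^sup>2 * (X \<omega> powr ?p * Y \<omega> * (Z (Suc n) \<omega>)\<^sup>2)
        + ?c * (Y \<omega> powr (q / 2) * \<bar>Z (Suc n) \<omega>\<bar> powr q)" for \<omega>
      unfolding square_sum_Suc X_def[symmetric] Y_def[symmetric] d_def[symmetric]
      using powr_quadratic_form_le[OF q nn CS] by (simp add: d_def)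
  qed (use intX e1 e2 e3 in auto)
  also have "\<dots> = expectation (\<lambda>\<omega>. X \<omega> powr (q / 2)) + 2 * q\<^sup>2 * expectation (\<lambda>\<omega>. X \<omega> powr ?p * Y \<omega>)
      + ?c * (expectation (\<lambda>\<omega>. Y \<omega> powr (q / 2)) * expectation (\<lambda>\<omega>. \<bar>Z (Suc n) \<omega>\<bar> powr q))"
    using intX e1 e2 e3 by simp
  also have "expectation (\<lambda>\<omega>. X \<omega> powr (q / 2)) + 2 * q\<^sup>2 * expectation (\<lambda>\<omega>. X \<omega> powr ?p * Y \<omega>)
      = expectation (\<lambda>\<omega>. X \<omega> powr (q / 2) + q / 2 * (X \<omega> powr ?p * (4 * q * Y \<omega>)))"
    unfolding tangent using intX intXpY by simp
  also have "\<dots> \<le> expectation (\<lambda>\<omega>. square_sum n Z (L @ map (\<lambda>b S. sqrt (4 * q) * shift_coeff n b S) L) \<omega> powr (q / 2))"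
  proof (rule integral_mono)
    show "integrable M (\<lambda>\<omega>. X \<omega> powr (q / 2) + q / 2 * (X \<omega> powr ?p * (4 * q * Y \<omega>)))"
      unfolding tangent using intX intXpY by simp
    show "X \<omega> powr (q / 2) + q / 2 * (X \<omega> powr ?p * (4 * q * Y \<omega>))
        \<le> square_sum n Z (L @ map (\<lambda>b S. sqrt (4 * q) * shift_coeff n b S) L) \<omega> powr (q / 2)" for \<omega>
      using powr_tangent_le[of "q / 2" "X \<omega>" "4 * q * Y \<omega>"] q nn[of \<omega>]
      by (simp add: square_sum_append square_sum_scale X_def Y_def)
  qed (rule int)
  finally show ?thesis by (simp add: Y_def mult_ac)
qed

end

text \<open>For \<open>\<gamma> = 1\<close> and \<open>S \<subseteq> {1..n}\<close> this is, by
  Parseval, the squared norm of the derivative along \<open>S\<close>; \<gamma> is the price of each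
  variable absorbed by the tangent inequality.\<close>

definition coeff_mass :: "real \<Rightarrow> nat \<Rightarrow> nat set \<Rightarrow> (nat set \<Rightarrow> real) \<Rightarrow> real" where
  "coeff_mass \<gamma> n S b = (\<Sum>T\<in>Pow ({1..n} - S). \<gamma> ^ card T * (b (S \<union> T))\<^sup>2)"

lemma coeff_mass_nonneg: "\<gamma> \<ge> 0 \<Longrightarrow> coeff_mass \<gamma> n S b \<ge> 0"
  by (auto simp: coeff_mass_def intro!: sum_nonneg)

text \<open>Sets \<open>T\<close> containing \<open>Suc n\<close> carry one extra factor \<gamma>,
  moved into the coefficients as \<open>sqrt \<gamma>\<close>. At \<open>\<gamma> = 4 * q\<close>
  this matches the families appended in \<open>expectation_square_sum_Suc_le\<close>.\<close>

lemma coeff_mass_Suc: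
  assumes "S \<subseteq> {1..n}" "\<gamma> \<ge> 0"
  shows "coeff_mass \<gamma> (Suc n) S b
    = coeff_mass \<gamma> n S b + coeff_mass \<gamma> n S (\<lambda>S. sqrt \<gamma> * shift_coeff n b S)"
proof -
  have "{1..Suc n} - S = insert (Suc n) ({1..n} - S)" using assms by auto
  moreover have "finite T" "Suc n \<notin> T" if "T \<in> Pow ({1..n} - S)" for T
    using that finite_subset[of T "{1..n}"] by auto
  ultimately show ?thesis
    using assms
    by (simp add: coeff_mass_def sum_Pow_insert shift_coeff_def power_mult_distrib algebra_simps
        del: One_nat_def)
qed

lemma coeff_mass_insert_Suc:
  assumes "S \<subseteq> {1..n}"
  shows "coeff_mass \<gamma> (Suc n) (insert (Suc n) S) b = coeff_mass \<gamma> n S (shift_coeff n b)"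
proof -
  have "{1..Suc n} - insert (Suc n) S = {1..n} - S" by auto
  then show ?thesis by (simp only: coeff_mass_def shift_coeff_def Un_insert_left)
qed

context prob_space
begin

text \<open>Induction on \<open>n\<close> for all lists at once. Of the two lists produced by
  removing the last variable, the extended one yields the sets \<open>S\<close> without
  \<open>Suc n\<close>, and the shifted one yields the sets containing it, with one more constant
  and one more moment.\<close>

theorem expectation_square_sum_powr_le:
  assumes q: "q > 2"
    and "indep_vars (\<lambda>_. borel) Z {1..n}"
    and "\<And>i. i \<in> {1..n} \<Longrightarrow> integrable M (Z i) \<and> expectation (Z i) = 0"
    and "\<And>i. i \<in> {1..n} \<Longrightarrow>
      integrable M (\<lambda>\<omega>. (Z i \<omega>)\<^sup>2) \<and> expectation (\<lambda>\<omega>. (Z i \<omega>)\<^sup>2) = 1"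
    and "\<And>i. i \<in> {1..n} \<Longrightarrow> integrable M (\<lambda>\<omega>. \<bar>Z i \<omega>\<bar> powr q)"
  shows "expectation (\<lambda>\<omega>. square_sum n Z L \<omega> powr (q / 2))
    \<le> (\<Sum>S\<in>Pow {1..n}. ((2 * q + 1) powr q) ^ card S
        * (\<Prod>i\<in>S. expectation (\<lambda>\<omega>. \<bar>Z i \<omega>\<bar> powr q))
        * (\<Sum>b\<leftarrow>L. coeff_mass (4 * q) n S b) powr (q / 2))"
  using assms(2-)
proof (induction n arbitrary: L)
  case 0
  then show ?case
    by (simp add: square_sum_def multilinear_def coeff_mass_def prob_space)
next
  case (Suc n)
  have indep: "indep_vars (\<lambda>_. borel) Z {1..n}"
    using Suc.prems(1) by (rule indep_vars_subset) auto
  let ?c = "(2 * q + 1) powr q" and ?m = "\<lambda>i. expectation (\<lambda>\<omega>. \<bar>Z i \<omega>\<bar> powr q)"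
  let ?L1 = "L @ map (\<lambda>b S. sqrt (4 * q) * shift_coeff n b S) L" and ?L2 = "map (shift_coeff n) L"
  let ?B = "\<lambda>n L S. ?c ^ card S * (\<Prod>i\<in>S. ?m i) * (\<Sum>b\<leftarrow>L. coeff_mass (4 * q) n S b) powr (q / 2)"
  have IH: "expectation (\<lambda>\<omega>. square_sum n Z L \<omega> powr (q / 2)) \<le> (\<Sum>S\<in>Pow {1..n}. ?B n L S)" for L
    by (rule Suc.IH[OF indep]) (use Suc.prems in auto)
  have 1: "?B n ?L1 S = ?B (Suc n) L S" if "S \<in> Pow {1..n}" for S
    using that q by (simp add: coeff_mass_Suc o_def sum_list_addf del: One_nat_def)
  have 2: "?c * ?m (Suc n) * ?B n ?L2 S = ?B (Suc n) L (insert (Suc n) S)" if S: "S \<in> Pow {1..n}" for S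
  proof -
    have "finite S" "Suc n \<notin> S" using S by (auto intro: finite_subset)
    then show ?thesis
      using S by (simp add: coeff_mass_insert_Suc o_def del: One_nat_def)
  qed
  have "expectation (\<lambda>\<omega>. square_sum (Suc n) Z L \<omega> powr (q / 2))
    \<le> expectation (\<lambda>\<omega>. square_sum n Z ?L1 \<omega> powr (q / 2))
      + ?c * ?m (Suc n) * expectation (\<lambda>\<omega>. square_sum n Z ?L2 \<omega> powr (q / 2))"
    by (rule expectation_square_sum_Suc_le[OF q Suc.prems(1)]) (use Suc.prems in auto)
  also have "\<dots> \<le> (\<Sum>S\<in>Pow {1..n}. ?B n ?L1 S) + ?c * ?m (Suc n) * (\<Sum>S\<in>Pow {1..n}. ?B n ?L2 S)"
    by (intro add_mono mult_left_mono IH) auto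
  also have "\<dots> = (\<Sum>S\<in>Pow {1..Suc n}. ?B (Suc n) L S)"
    unfolding sum_Pow_Suc sum_distrib_left
    by (intro arg_cong2[where f = "(+)"] sum.cong refl 1 2)
  finally show ?case .
qed

section \<open>Influences and the moment of the noise operator\<close>

lemma Lnorm_2_sq:
  assumes "integrable M (\<lambda>\<omega>. (F \<omega>)\<^sup>2)"
  shows "(Lnorm M 2 F)\<^sup>2 = expectation (\<lambda>\<omega>. (F \<omega>)\<^sup>2)"
proof -
  have "expectation (\<lambda>\<omega>. (F \<omega>)\<^sup>2) \<ge> 0" by simp
  then show ?thesis by (simp add: Lnorm_def powr_half_sqrt)
qed

text \<open>Parseval's identity for the derivative, seen as a multilinear polynomial whose
  coefficients vanish on sets meeting \<open>S\<close>.\<close>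

lemma gen_influence_eq:
  assumes "indep_vars (\<lambda>_. borel) Z {1..n}"
    and "\<And>i. i \<in> {1..n} \<Longrightarrow> integrable M (Z i) \<and> expectation (Z i) = 0"
    and "\<And>i. i \<in> {1..n} \<Longrightarrow>
      integrable M (\<lambda>\<omega>. (Z i \<omega>)\<^sup>2) \<and> expectation (\<lambda>\<omega>. (Z i \<omega>)\<^sup>2) = 1"
    and S: "S \<subseteq> {1..n}"
  shows "gen_influence M n Z \<sigma> S a = (\<Sum>T\<in>Pow ({1..n} - S). (a (S \<union> T))\<^sup>2) / (\<Prod>i\<in>S. \<sigma> i)\<^sup>2"
proof -
  let ?b = "\<lambda>T. inverse (\<Prod>i\<in>S. \<sigma> i) * (if T \<inter> S = {} then a (T \<union> S) else 0)"
  note E = expectation_multilinear_square[OF assms(1-3)]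
  have "gen_influence M n Z \<sigma> S a = (Lnorm M 2 (multilinear n Z ?b))\<^sup>2"
    unfolding gen_influence_def deriv_op_multilinear[OF S] multilinear_scale ..
  also have "\<dots> = (\<Sum>T\<in>Pow {1..n}. (?b T)\<^sup>2)"
    using E by (simp only: Lnorm_2_sq)
  also have "\<dots> = (\<Sum>T\<in>Pow ({1..n} - S). (inverse (\<Prod>i\<in>S. \<sigma> i))\<^sup>2 * (a (S \<union> T))\<^sup>2)"
    by (rule sum.mono_neutral_cong_right) (auto simp: power_mult_distrib Un_commute)
  also have "\<dots> = (\<Sum>T\<in>Pow ({1..n} - S). (a (S \<union> T))\<^sup>2) / (\<Prod>i\<in>S. \<sigma> i)\<^sup>2"
    by (simp add: divide_inverse power_inverse mult.commute flip: sum_distrib_left)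
  finally show ?thesis .
qed

theorem noise_op_powr_le:
  assumes q: "q > 2" and \<beta>: "\<beta> > 0" and \<rho>: "0 \<le> \<rho>" "\<rho> \<le> (2 * q) powr (-1.5)"
    and indep: "indep_vars (\<lambda>_. borel) Z {1..n}"
    and Z1: "\<And>i. i \<in> {1..n} \<Longrightarrow> integrable M (Z i) \<and> expectation (Z i) = 0"
    and Z2: "\<And>i. i \<in> {1..n} \<Longrightarrow>
      integrable M (\<lambda>\<omega>. (Z i \<omega>)\<^sup>2) \<and> expectation (\<lambda>\<omega>. (Z i \<omega>)\<^sup>2) = 1"
    and \<sigma>: "\<And>i. i \<in> {1..n} \<Longrightarrow> \<sigma> i > 0"
    and Zq: "\<And>i. i \<in> {1..n} \<Longrightarrow> integrable M (\<lambda>\<omega>. \<bar>Z i \<omega>\<bar> powr q) \<and>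
      expectation (\<lambda>\<omega>. \<bar>Z i \<omega>\<bar> powr q) = \<sigma> i powr (2 - q)"
    and infl: "\<And>S. S \<subseteq> {1..n} \<Longrightarrow> gen_influence M n Z \<sigma> S a \<le> \<beta> * A"
    and A: "A = (\<Sum>S\<in>Pow {1..n}. (a S)\<^sup>2)"
  shows "expectation (\<lambda>\<omega>. \<bar>noise_op n Z \<rho> a \<omega>\<bar> powr q) \<le> (\<beta> * A) powr ((q - 2) / 2) * A"
proof -
  let ?c = "(2 * q + 1) powr q" and ?b = "\<lambda>S. \<rho> ^ card S * a S" and ?r = "(q - 2) / 2"
  \<comment> \<open>With the noise included, each element of \<open>T\<close> costs \<gamma> and
    each element of \<open>S\<close> costs \<alpha>, apart from its moment.\<close>
  define \<gamma> where "\<gamma> = 4 * q * \<rho>\<^sup>2"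
  define \<alpha> where "\<alpha> = ?c * \<rho> powr q"
  have \<gamma>\<alpha>: "0 \<le> \<gamma>" "0 \<le> \<alpha>" "\<alpha> + \<gamma> \<le> 1"
    using noise_constant_le_one[OF q \<rho>] q by (auto simp: \<gamma>_def \<alpha>_def)
  have A0: "A \<ge> 0" unfolding A by (intro sum_nonneg) auto
  have summand: "?c ^ card S * (\<Prod>i\<in>S. expectation (\<lambda>\<omega>. \<bar>Z i \<omega>\<bar> powr q)) * coeff_mass (4 * q) n S ?b powr (q / 2)
      \<le> (\<beta> * A) powr ?r * (\<alpha> ^ card S * coeff_mass \<gamma> n S a)" if S: "S \<in> Pow {1..n}" for S
  proof -
    have fin: "finite S" using S by (auto intro: finite_subset)
    define s where "s = (\<Prod>i\<in>S. \<sigma> i)"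
    have s: "s > 0" unfolding s_def using S \<sigma> by (intro prod_pos) auto
    have m: "(\<Prod>i\<in>S. expectation (\<lambda>\<omega>. \<bar>Z i \<omega>\<bar> powr q)) = s powr (2 - q)"
    proof -
      have "(\<Prod>i\<in>S. expectation (\<lambda>\<omega>. \<bar>Z i \<omega>\<bar> powr q)) = (\<Prod>i\<in>S. \<sigma> i powr (2 - q))"
        using S Zq by (intro prod.cong) auto
      also have "\<dots> = s powr (2 - q)"
        unfolding s_def by (rule prod_powr_distrib[symmetric])
      finally show ?thesis .
    qed
    define B where "B = coeff_mass \<gamma> n S a"
    have B0: "B \<ge> 0" unfolding B_def by (rule coeff_mass_nonneg[OF \<gamma>\<alpha>(1)])
    \<comment> \<open>Since \<open>S\<close> and \<open>T\<close> are disjoint, the noise factor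
      splits: the share of \<open>T\<close> turns \<open>4 * q\<close> into \<gamma>, and the share
      of \<open>S\<close> comes out of the sum.\<close>
    have "coeff_mass (4 * q) n S ?b = (\<rho> ^ card S)\<^sup>2 * B"
      unfolding coeff_mass_def B_def sum_distrib_left
    proof (rule sum.cong)
      fix T assume T: "T \<in> Pow ({1..n} - S)"
      then have "finite T" "S \<inter> T = {}" using finite_subset[of T "{1..n}"] by auto
      then have "card (S \<union> T) = card S + card T" using fin by (simp add: card_Un_disjoint)
      then show "(4 * q) ^ card T * (?b (S \<union> T))\<^sup>2
          = (\<rho> ^ card S)\<^sup>2 * (\<gamma> ^ card T * (a (S \<union> T))\<^sup>2)"
        by (simp add: \<gamma>_def power_add power_mult_distrib power_mult[symmetric] mult.commute[of 2] algebra_simps)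
    qed simp
    then have "coeff_mass (4 * q) n S ?b powr (q / 2) = (\<rho> ^ card S) powr q * B powr (q / 2)"
      using \<rho>(1) abs_powr_eq_power2_powr[of "\<rho> ^ card S" q] by (simp add: powr_mult)
    also have "(\<rho> ^ k) powr q = (\<rho> powr q) ^ k" for k
      using \<rho>(1) by (induction k) (auto simp: powr_mult)
    finally have mass: "coeff_mass (4 * q) n S ?b powr (q / 2) = (\<rho> powr q) ^ card S * B powr (q / 2)" .
    \<comment> \<open>Here \<open>\<gamma> \<le> 1\<close> discards the weights and leaves the
      unweighted mass that the influence controls.\<close>
    have "B \<le> (\<Sum>T\<in>Pow ({1..n} - S). (a (S \<union> T))\<^sup>2)"
      unfolding B_def coeff_mass_def using \<gamma>\<alpha>
      by (intro sum_mono mult_left_le_one_le power_le_one) auto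
    also have "\<dots> = s\<^sup>2 * gen_influence M n Z \<sigma> S a"
      using gen_influence_eq[OF indep Z1 Z2, of S \<sigma> a] S s by (simp add: s_def)
    also have "\<dots> \<le> s\<^sup>2 * (\<beta> * A)" using infl S by (intro mult_left_mono) auto
    finally have "B powr ?r \<le> (s\<^sup>2 * (\<beta> * A)) powr ?r"
      using B0 q by (intro powr_mono2) auto
    also have "\<dots> = s powr (q - 2) * (\<beta> * A) powr ?r"
      using s \<beta> A0 abs_powr_eq_power2_powr[of s "q - 2"] by (simp add: powr_mult)
    finally have Br: "B powr ?r \<le> s powr (q - 2) * (\<beta> * A) powr ?r" .
    \<comment> \<open>Only the factor \<open>B powr ?r\<close> is estimated by the influence; its
      \<open>s powr (q - 2)\<close> cancels the moments \<open>s powr (2 - q)\<close>. The remaining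
      \<open>B\<close> is kept for the summation over \<open>S\<close>.\<close>
    have "B powr (q / 2) = B * B powr ?r"
      using powr_mult_base[OF B0, of ?r] by (simp add: diff_divide_distrib)
    then have "s powr (2 - q) * B powr (q / 2) \<le> s powr (2 - q) * (B * (s powr (q - 2) * (\<beta> * A) powr ?r))"
      using Br B0 by (auto intro!: mult_left_mono)
    also have "\<dots> = (s powr (2 - q) * s powr (q - 2)) * ((\<beta> * A) powr ?r * B)"
      by (simp add: mult_ac)
    also have "s powr (2 - q) * s powr (q - 2) = 1"
      using s by (simp flip: powr_add)
    finally have "s powr (2 - q) * B powr (q / 2) \<le> (\<beta> * A) powr ?r * B" by simp
    then have "\<alpha> ^ card S * (s powr (2 - q) * B powr (q / 2)) \<le> \<alpha> ^ card S * ((\<beta> * A) powr ?r * B)"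
      using \<gamma>\<alpha> by (intro mult_left_mono) auto
    then show ?thesis
      unfolding m mass by (simp add: \<alpha>_def B_def power_mult_distrib mult_ac)
  qed
  have "expectation (\<lambda>\<omega>. \<bar>noise_op n Z \<rho> a \<omega>\<bar> powr q)
      = expectation (\<lambda>\<omega>. square_sum n Z [?b] \<omega> powr (q / 2))"
    by (simp add: noise_op_multilinear square_sum_def abs_powr_eq_power2_powr)
  also have "\<dots> \<le> (\<Sum>S\<in>Pow {1..n}. ?c ^ card S
      * (\<Prod>i\<in>S. expectation (\<lambda>\<omega>. \<bar>Z i \<omega>\<bar> powr q))
      * coeff_mass (4 * q) n S ?b powr (q / 2))"
    using expectation_square_sum_powr_le[OF q indep Z1 Z2, of "[?b]"] Zq by simp
  also have "\<dots> \<le> (\<Sum>S\<in>Pow {1..n}. (\<beta> * A) powr ?r * (\<alpha> ^ card S * coeff_mass \<gamma> n S a))"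
    by (rule sum_mono[OF summand])
  \<comment> \<open>The double sum over disjoint \<open>S\<close> and \<open>T\<close> collapses to
    their union, after which \<open>\<alpha> + \<gamma> \<le> 1\<close> removes the weights.\<close>
  also have "\<dots> = (\<beta> * A) powr ?r * (\<Sum>U\<in>Pow {1..n}. (\<alpha> + \<gamma>) ^ card U * (a U)\<^sup>2)"
    unfolding sum_distrib_left[symmetric] coeff_mass_def
    by (subst sum_Pow_disjoint_pairs) auto
  also have "\<dots> \<le> (\<beta> * A) powr ?r * A"
    unfolding A using \<gamma>\<alpha>
    by (intro mult_left_mono sum_mono mult_left_le_one_le power_le_one) auto
  finally show ?thesis .
qed

end

theorem theorem7p8:
  fixes M :: "'a measure" and n :: nat and Z :: "nat \<Rightarrow> 'a \<Rightarrow> real"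
    and \<sigma> :: "nat \<Rightarrow> real" and a :: "nat set \<Rightarrow> real" and q \<beta> \<rho> :: real
  assumes "prob_space M"
    and "q > 2" and "\<beta> > 0" and "0 \<le> \<rho>" and "\<rho> \<le> (2 * q) powr (-1.5)"
    and "prob_space.indep_vars M (\<lambda>_. borel) Z {1..n}"
    and "\<And>i. i \<in> {1..n} \<Longrightarrow> integrable M (Z i) \<and> (\<integral>\<omega>. Z i \<omega> \<partial>M) = 0"
    and "\<And>i. i \<in> {1..n} \<Longrightarrow>
           integrable M (\<lambda>\<omega>. (Z i \<omega>)\<^sup>2) \<and> (\<integral>\<omega>. (Z i \<omega>)\<^sup>2 \<partial>M) = 1"
    and "\<And>i. i \<in> {1..n} \<Longrightarrow> \<sigma> i > 0"
    and "\<And>i. i \<in> {1..n} \<Longrightarrow> integrable M (\<lambda>\<omega>. \<bar>Z i \<omega>\<bar> powr q) \<and>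
           (\<integral>\<omega>. \<bar>Z i \<omega>\<bar> powr q \<partial>M) = \<sigma> i powr (2 - q)"
    and "\<And>S. S \<subseteq> {1..n} \<Longrightarrow>
           gen_influence M n Z \<sigma> S a \<le> \<beta> * (Lnorm M 2 (multilinear n Z a))\<^sup>2"
  shows "Lnorm M q (noise_op n Z \<rho> a)
           \<le> \<beta> powr ((q - 2) / (2 * q)) * Lnorm M 2 (multilinear n Z a)"
proof -
  interpret prob_space M by fact
  define N where "N = Lnorm M 2 (multilinear n Z a)"
  have N0: "N \<ge> 0" by (simp add: N_def Lnorm_def)
  have "N\<^sup>2 = (\<Sum>S\<in>Pow {1..n}. (a S)\<^sup>2)"
    unfolding N_def using expectation_multilinear_square[OF assms(6-8)] by (simp only: Lnorm_2_sq)
  from noise_op_powr_le[OF assms(2-6,7-10) assms(11)[folded N_def] this]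
  have "expectation (\<lambda>\<omega>. \<bar>noise_op n Z \<rho> a \<omega>\<bar> powr q) \<le> (\<beta> * N\<^sup>2) powr ((q - 2) / 2) * N\<^sup>2" .
  also have "\<dots> = \<beta> powr ((q - 2) / 2) * (N powr (q - 2) * N powr 2)"
    using N0 assms(3) abs_powr_eq_power2_powr[of N "q - 2"] by (simp add: powr_mult)
  \<comment> \<open>This includes \<open>N = 0\<close>, where all three powers are 0 by
    convention.\<close>
  also have "N powr (q - 2) * N powr 2 = N powr q"
    by (simp flip: powr_add)
  finally have "Lnorm M q (noise_op n Z \<rho> a) \<le> (\<beta> powr ((q - 2) / 2) * N powr q) powr (1 / q)"
    unfolding Lnorm_def using assms(2) by (intro powr_mono2) auto
  also have "\<dots> = \<beta> powr ((q - 2) / (2 * q)) * N"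
    using assms(2,3) N0 by (simp add: powr_mult powr_powr)
  finally show ?thesis by (simp add: N_def)
qed

end
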